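(* Let $n\ge 0$ be an integer and let $(X,\|\cdot\|)$ be a real normed space of dimension $d\ge n$. Then the $n$-dual space $X^{(n)}$ of $(X,\|\cdot\|)$, with the norm $\|\cdot\|_{n,1}$, is a Banach space.
   Context: Let $X$ be a real normed space with norm $\|\cdot\|$ (its dimension may be infinite; $X$ is not assumed complete). For $n\ge 1$, an $n$-functional on $X$ is a function $f:X^n\to\mathbb{R}$. It is multilinear if it is linear in each variable separately, and it is bounded on $(X,\|\cdot\|)$ if there is $K>0$ with $|f(x_1,\ldots,x_n)|\le K\|x_1\|\cdots\|x_n\|$ for all $x_1,\ldots,x_n\in X$. The $n$-dual space $X^{(n)}$ of $(X,\|\cdot\|)$ is the vector space of all bounded multilinear $n$-functionals on $(X,\|\cdot\|)$ with pointwise operations and the norm $$\|f\|_{n,1}:=\sup_{x_1,\ldots,x_n\ne 0}\frac{|f(x_1,\ldots,x_n)|}{\|x_1\|\cdots\|x_n\|}.$$ By convention $X^{(0)}:=\mathbb{R}$ with the absolute value as norm. *)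

theory Defs
  imports Complex_Main "HOL-Library.Function_Algebras"
begin

instantiation "fun" :: (type, real_vector) real_vector
begin

definition scaleR_fun :: "real \<Rightarrow> ('a \<Rightarrow> 'b) \<Rightarrow> 'a \<Rightarrow> 'b"
  where "scaleR_fun c f = (\<lambda>x. c *\<^sub>R f x)"

instance
  by standard (auto simp: scaleR_fun_def plus_fun_def fun_eq_iff algebra_simps)

end

locale normed_space_on =
  fixes V :: "'v::real_vector set" and N :: "'v \<Rightarrow> real"
  assumes subspace: "subspace V"
    and norm_nonneg: "f \<in> V \<Longrightarrow> 0 \<le> N f"
    and norm_eq_zero: "f \<in> V \<Longrightarrow> N f = 0 \<longleftrightarrow> f = 0"
    and norm_triangle: "f \<in> V \<Longrightarrow> g \<in> V \<Longrightarrow> N (f + g) \<le> N f + N g"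
    and norm_scaleR: "f \<in> V \<Longrightarrow> N (c *\<^sub>R f) = \<bar>c\<bar> * N f"

locale banach_space_on = normed_space_on +
  assumes complete:
    "(\<forall>k. s k \<in> V) \<Longrightarrow> (\<forall>e>0. \<exists>M. \<forall>j\<ge>M. \<forall>k\<ge>M. N (s j - s k) < e)
      \<Longrightarrow> \<exists>l\<in>V. (\<lambda>k. N (s k - l)) \<longlonglongrightarrow> 0"

text \<open>A point of \<open>X\<^sup>n\<close> is a list of length \<open>n\<close>. A functional on \<open>X\<^sup>n\<close> is a function on all lists
  whose values at lists of other lengths are irrelevant to the three notions below.\<close>

definition multilinear :: "nat \<Rightarrow> ('a::real_vector list \<Rightarrow> real) \<Rightarrow> bool"
  where "multilinear n f \<longleftrightarrow> (\<forall>xs i. length xs = n \<longrightarrow> i < n \<longrightarrow> linear (\<lambda>v. f (xs[i := v])))"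

definition bounded_functional :: "nat \<Rightarrow> ('a::real_normed_vector list \<Rightarrow> real) \<Rightarrow> bool"
  where "bounded_functional n f \<longleftrightarrow>
    (\<exists>K>0. \<forall>xs. length xs = n \<longrightarrow> \<bar>f xs\<bar> \<le> K * prod_list (map norm xs))"

definition ndual_norm :: "nat \<Rightarrow> ('a::real_normed_vector list \<Rightarrow> real) \<Rightarrow> real"
  where "ndual_norm n f =
    Sup {\<bar>f xs\<bar> / prod_list (map norm xs) | xs. length xs = n \<and> (\<forall>x\<in>set xs. x \<noteq> 0)}"

text \<open>The last condition makes each functional on \<open>X\<^sup>n\<close> correspond to exactly one element.\<close>

definition ndual :: "nat \<Rightarrow> ('a::real_normed_vector list \<Rightarrow> real) set"
  where "ndual n =
    {f. multilinear n f \<and> bounded_functional n f \<and> (\<forall>xs. length xs \<noteq> n \<longrightarrow> f xs = 0)}"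

text \<open>For \<open>n = 0\<close> the definitions give the convention \<open>X\<^sup>(\<^sup>0\<^sup>) = \<real>\<close>, up to the linear isometry that
  evaluates a functional at the empty tuple.\<close>

lemma bij_betw_ndual_0: "bij_betw (\<lambda>f. f []) (ndual 0 :: ('a::real_normed_vector list \<Rightarrow> real) set) UNIV"
proof (rule bij_betw_byWitness[where f' = "\<lambda>c xs. if xs = [] then c else 0"])
  show "range (\<lambda>c (xs::'a list). if xs = [] then c else 0) \<subseteq> ndual 0"
  proof (clarsimp simp: ndual_def multilinear_def bounded_functional_def)
    fix c :: real
    show "\<exists>K>0. \<bar>c\<bar> \<le> K"
      by (rule exI[of _ "\<bar>c\<bar> + 1"]) auto
  qed
qed (auto simp: ndual_def fun_eq_iff)

lemma linear_eval: "linear (\<lambda>f :: 'b \<Rightarrow> real. f x)"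
  by (rule linearI) (simp_all add: scaleR_fun_def)

lemma ndual_norm_0: "ndual_norm 0 f = \<bar>f []\<bar>"
proof -
  have "{\<bar>f xs\<bar> / prod_list (map norm xs) | xs. length xs = 0 \<and> (\<forall>x\<in>set xs. x \<noteq> 0)} = {\<bar>f []\<bar>}"
    by auto
  then show ?thesis
    by (simp only: ndual_norm_def cSup_singleton)
qed

end

theory Submission
  imports Defs
begin

text \<open>The norm \<open>ndual_norm n f\<close> is the least constant \<open>K\<close> with
  \<open>\<bar>f xs\<bar> \<le> K * prod_list (map norm xs)\<close>. A Cauchy sequence of functionals therefore converges
  pointwise, uniformly relative to \<open>prod_list (map norm xs)\<close>; multilinearity and boundedness pass to
  the pointwise limit. The dimension hypothesis only serves to provide a nonzero vector when
  \<open>n > 0\<close>, so that the supremum is not taken over the empty set.\<close>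

section \<open>The norm as least bounding constant\<close>

lemma prod_list_norm_nonneg: "0 \<le> prod_list (map norm xs)"
  by (induction xs) auto

lemma prod_list_norm_pos: "\<forall>x\<in>set xs. x \<noteq> 0 \<Longrightarrow> 0 < prod_list (map norm xs)"
  by (induction xs) auto

text \<open>Overwriting the zero entry with 0 changes nothing, so \<open>f xs\<close> is the value
  at 0 of a linear map.\<close>

lemma multilinear_coordinate_zero:
  assumes "multilinear n f" "length xs = n" "0 \<in> set xs"
  shows "f xs = 0"
proof -
  from \<open>0 \<in> set xs\<close> obtain i where i: "i < length xs" "xs ! i = 0"
    by (auto simp: in_set_conv_nth)
  then have "linear (\<lambda>v. f (xs[i := v]))"
    using assms by (auto simp: multilinear_def)
  then have "f (xs[i := 0]) = 0"
    by (rule linear_0)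
  with i show ?thesis
    by (metis list_update_id)
qed

text \<open>The supremum only sees tuples without zero entries, and boundedness of \<open>f\<close>
  makes it an upper bound there. At a tuple with a zero entry both sides vanish.\<close>

lemma abs_le_ndual_norm:
  assumes f: "f \<in> ndual n" and xs: "length xs = n"
  shows "\<bar>f xs\<bar> \<le> ndual_norm n f * prod_list (map norm xs)"
proof (cases "0 \<in> set xs")
  case True
  then have "f xs = 0"
    using f xs by (intro multilinear_coordinate_zero) (auto simp: ndual_def)
  moreover have "prod_list (map norm xs) = 0"
    using True by (auto simp: prod_list_zero_iff)
  ultimately show ?thesis by simp
next
  case False
  let ?S = "{\<bar>f xs\<bar> / prod_list (map norm xs) | xs. length xs = n \<and> (\<forall>x\<in>set xs. x \<noteq> 0)}"
  obtain K where K: "\<And>xs. length xs = n \<Longrightarrow> \<bar>f xs\<bar> \<le> K * prod_list (map norm xs)"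
    using f by (auto simp: ndual_def bounded_functional_def)
  have "bdd_above ?S"
    by (rule bdd_aboveI[of _ K]) (auto simp: pos_divide_le_eq[OF prod_list_norm_pos] K)
  moreover have nz: "\<forall>x\<in>set xs. x \<noteq> 0"
    using False by auto
  ultimately have "\<bar>f xs\<bar> / prod_list (map norm xs) \<le> ndual_norm n f"
    unfolding ndual_norm_def using xs by (intro cSup_upper) auto
  then show ?thesis
    using prod_list_norm_pos[OF nz] by (simp add: pos_divide_le_eq)
qed

lemma ndual_norm_le:
  fixes f :: "'a::real_normed_vector list \<Rightarrow> real"
  assumes nontrivial: "n = 0 \<or> (\<exists>x::'a. x \<noteq> 0)"
    and le: "\<And>xs. length xs = n \<Longrightarrow> \<bar>f xs\<bar> \<le> K * prod_list (map norm xs)"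
  shows "ndual_norm n f \<le> K"
  unfolding ndual_norm_def
proof (rule cSup_least)
  \<comment> \<open>The constant tuple of a nonzero vector, or the empty tuple if
    \<open>n = 0\<close>, is a witness that the set of quotients is nonempty.\<close>
  obtain x :: 'a where "n = 0 \<or> x \<noteq> 0"
    using nontrivial by auto
  then have "length (replicate n x) = n \<and> (\<forall>y\<in>set (replicate n x). y \<noteq> 0)"
    by auto
  then show "{\<bar>f xs\<bar> / prod_list (map norm xs) | xs. length xs = n \<and> (\<forall>x\<in>set xs. x \<noteq> 0)} \<noteq> {}"
    by blast
qed (auto simp: pos_divide_le_eq[OF prod_list_norm_pos] le)

text \<open>At a tuple whose product of norms is positive, \<open>abs_le_ndual_norm\<close> leaves
  no room for a negative factor.\<close>

lemma ndual_norm_nonneg: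
  fixes f :: "'a::real_normed_vector list \<Rightarrow> real"
  assumes nontrivial: "n = 0 \<or> (\<exists>x::'a. x \<noteq> 0)" and f: "f \<in> ndual n"
  shows "0 \<le> ndual_norm n f"
proof -
  obtain x :: 'a where "n = 0 \<or> x \<noteq> 0"
    using nontrivial by auto
  then have pos: "0 < prod_list (map norm (replicate n x))"
    by (intro prod_list_norm_pos) auto
  have "0 \<le> \<bar>f (replicate n x)\<bar>"
    by simp
  also have "\<dots> \<le> ndual_norm n f * prod_list (map norm (replicate n x))"
    by (rule abs_le_ndual_norm[OF f]) simp
  finally show ?thesis
    using pos by (simp add: zero_le_mult_iff)
qed

section \<open>The normed space structure\<close>

lemma ndualI:
  assumes "multilinear n f" "\<And>xs. length xs \<noteq> n \<Longrightarrow> f xs = 0"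
    and "\<And>xs. length xs = n \<Longrightarrow> \<bar>f xs\<bar> \<le> K * prod_list (map norm xs)"
  shows "f \<in> ndual n"
proof -
  \<comment> \<open>\<open>bounded_functional\<close> asks for a positive constant, whereas
    \<open>K\<close> may be 0 or negative.\<close>
  have "\<bar>f xs\<bar> \<le> max 1 K * prod_list (map norm xs)" if "length xs = n" for xs
    using assms(3)[OF that] mult_right_mono[OF max.cobounded2[of K 1] prod_list_norm_nonneg[of xs]]
    by linarith
  then have "bounded_functional n f"
    unfolding bounded_functional_def by (intro exI[of _ "max 1 K"]) auto
  with assms show ?thesis
    by (auto simp: ndual_def)
qed

lemma multilinear_add:
  "multilinear n f \<Longrightarrow> multilinear n g \<Longrightarrow> multilinear n (f + g)"
  by (auto simp: multilinear_def intro: linear_compose_add)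

lemma multilinear_scaleR: "multilinear n f \<Longrightarrow> multilinear n (c *\<^sub>R f)"
  unfolding multilinear_def scaleR_fun_def by (intro allI impI linear_compose_scale_right) simp

lemma subspace_ndual: "subspace (ndual n)"
proof (rule subspaceI)
  show "0 \<in> ndual n"
    by (rule ndualI[where K = 0]) (auto simp: multilinear_def linear_zero)
next
  fix f g :: "'a list \<Rightarrow> real"
  assume f: "f \<in> ndual n" and g: "g \<in> ndual n"
  show "f + g \<in> ndual n"
  proof (rule ndualI)
    show "multilinear n (f + g)"
      using f g by (auto simp: ndual_def intro: multilinear_add)
    show "(f + g) xs = 0" if "length xs \<noteq> n" for xs
      using f g that by (auto simp: ndual_def)
    show "\<bar>(f + g) xs\<bar> \<le> (ndual_norm n f + ndual_norm n g) * prod_list (map norm xs)"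
      if "length xs = n" for xs
      using abs_le_ndual_norm[OF f that] abs_le_ndual_norm[OF g that]
      by (simp add: distrib_right)
  qed
next
  fix c :: real and f :: "'a list \<Rightarrow> real"
  assume f: "f \<in> ndual n"
  show "c *\<^sub>R f \<in> ndual n"
  proof (rule ndualI)
    show "multilinear n (c *\<^sub>R f)"
      using f by (auto simp: ndual_def intro: multilinear_scaleR)
    show "(c *\<^sub>R f) xs = 0" if "length xs \<noteq> n" for xs
      using f that by (auto simp: ndual_def scaleR_fun_def)
    show "\<bar>(c *\<^sub>R f) xs\<bar> \<le> (\<bar>c\<bar> * ndual_norm n f) * prod_list (map norm xs)"
      if "length xs = n" for xs
      using mult_left_mono[OF abs_le_ndual_norm[OF f that], of "\<bar>c\<bar>"]
      by (simp add: scaleR_fun_def abs_mult mult.assoc)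
  qed
qed

text \<open>One half of homogeneity; for nonzero \<open>c\<close> the other half follows by applying
  this one to \<open>inverse c\<close> and \<open>c *\<^sub>R f\<close>.\<close>

lemma ndual_norm_scaleR_le:
  fixes f :: "'a::real_normed_vector list \<Rightarrow> real"
  assumes "n = 0 \<or> (\<exists>x::'a. x \<noteq> 0)" "f \<in> ndual n"
  shows "ndual_norm n (c *\<^sub>R f) \<le> \<bar>c\<bar> * ndual_norm n f"
proof (rule ndual_norm_le[OF assms(1)])
  show "\<bar>(c *\<^sub>R f) xs\<bar> \<le> (\<bar>c\<bar> * ndual_norm n f) * prod_list (map norm xs)"
    if "length xs = n" for xs
    using mult_left_mono[OF abs_le_ndual_norm[OF assms(2) that], of "\<bar>c\<bar>"]
    by (simp add: scaleR_fun_def abs_mult mult.assoc)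
qed

lemma normed_space_on_ndual:
  assumes nontrivial: "n = 0 \<or> (\<exists>x::'a::real_normed_vector. x \<noteq> 0)"
  shows "normed_space_on (ndual n :: ('a list \<Rightarrow> real) set) (ndual_norm n)"
proof
  show "subspace (ndual n :: ('a list \<Rightarrow> real) set)"
    by (rule subspace_ndual)
next
  fix f :: "'a list \<Rightarrow> real" assume f: "f \<in> ndual n"
  show "0 \<le> ndual_norm n f"
    by (rule ndual_norm_nonneg[OF nontrivial f])
  show "ndual_norm n f = 0 \<longleftrightarrow> f = 0"
  proof
    assume "ndual_norm n f = 0"
    \<comment> \<open>The norm controls only lists of length \<open>n\<close>; at all others
      \<open>f\<close> vanishes by the last condition in \<open>ndual\<close>, which makes the norm
      definite.\<close>
    then have "f xs = 0" for xs
      using abs_le_ndual_norm[OF f] f by (cases "length xs = n") (auto simp: ndual_def)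
    then show "f = 0"
      by (simp add: fun_eq_iff)
  next
    assume "f = 0"
    then have "ndual_norm n f \<le> 0"
      by (intro ndual_norm_le[OF nontrivial]) simp
    then show "ndual_norm n f = 0"
      using ndual_norm_nonneg[OF nontrivial f] by simp
  qed
next
  fix f g :: "'a list \<Rightarrow> real" assume f: "f \<in> ndual n" and g: "g \<in> ndual n"
  show "ndual_norm n (f + g) \<le> ndual_norm n f + ndual_norm n g"
  proof (rule ndual_norm_le[OF nontrivial])
    show "\<bar>(f + g) xs\<bar> \<le> (ndual_norm n f + ndual_norm n g) * prod_list (map norm xs)"
      if "length xs = n" for xs
      using abs_le_ndual_norm[OF f that] abs_le_ndual_norm[OF g that]
      by (simp add: distrib_right)
  qed
next
  fix f :: "'a list \<Rightarrow> real" and c assume f: "f \<in> ndual n"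
  show "ndual_norm n (c *\<^sub>R f) = \<bar>c\<bar> * ndual_norm n f"
  proof (cases "c = 0")
    case True
    have "0 \<le> ndual_norm n (c *\<^sub>R f)"
      by (rule ndual_norm_nonneg[OF nontrivial subspace_scale[OF subspace_ndual f]])
    then show ?thesis
      using ndual_norm_scaleR_le[OF nontrivial f, of c] True by simp
  next
    case False
    have "ndual_norm n f = ndual_norm n (inverse c *\<^sub>R (c *\<^sub>R f))"
      using False by simp
    also have "\<dots> \<le> \<bar>inverse c\<bar> * ndual_norm n (c *\<^sub>R f)"
      by (rule ndual_norm_scaleR_le[OF nontrivial subspace_scale[OF subspace_ndual f]])
    finally have "\<bar>c\<bar> * ndual_norm n f \<le> ndual_norm n (c *\<^sub>R f)"
      using False by (simp add: field_simps)
    then show ?thesis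
      using ndual_norm_scaleR_le[OF nontrivial f, of c] by simp
  qed
qed

section \<open>Completeness\<close>

lemma multilinear_pointwise_limit:
  assumes s: "\<And>k. multilinear n (s k)" and lim: "\<And>xs. (\<lambda>k. s k xs) \<longlonglongrightarrow> l xs"
  shows "multilinear n l"
  unfolding multilinear_def
proof (intro allI impI)
  fix xs :: "'a list" and i
  assume i: "length xs = n" "i < n"
  then have lin: "linear (\<lambda>v. s k (xs[i := v]))" for k
    using s by (auto simp: multilinear_def)
  show "linear (\<lambda>v. l (xs[i := v]))"
  proof (rule linearI)
    fix u v :: 'a
    \<comment> \<open>Additivity, and likewise homogeneity below, is an equation between finitely
      many values, so it survives pointwise limits by their uniqueness.\<close>
    have "(\<lambda>k. s k (xs[i := u + v])) \<longlonglongrightarrow> l (xs[i := u]) + l (xs[i := v])"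
      by (simp add: linear_add[OF lin] tendsto_add lim)
    then show "l (xs[i := u + v]) = l (xs[i := u]) + l (xs[i := v])"
      using lim LIMSEQ_unique by blast
  next
    fix c :: real and v :: 'a
    have "(\<lambda>k. s k (xs[i := c *\<^sub>R v])) \<longlonglongrightarrow> c *\<^sub>R l (xs[i := v])"
      by (simp only: linear_scale[OF lin]) (intro tendsto_intros lim)
    then show "l (xs[i := c *\<^sub>R v]) = c *\<^sub>R l (xs[i := v])"
      using lim LIMSEQ_unique by blast
  qed
qed

lemma ndual_complete:
  fixes s :: "nat \<Rightarrow> 'a::real_normed_vector list \<Rightarrow> real"
  assumes nontrivial: "n = 0 \<or> (\<exists>x::'a. x \<noteq> 0)"
    and s: "\<And>k. s k \<in> ndual n"
    and cauchy: "\<And>e. e > 0 \<Longrightarrow> \<exists>M. \<forall>j\<ge>M. \<forall>k\<ge>M. ndual_norm n (s j - s k) < e"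
  shows "\<exists>l\<in>ndual n. (\<lambda>k. ndual_norm n (s k - l)) \<longlonglongrightarrow> 0"
proof -
  have diff: "s j - s k \<in> ndual n" for j k
    by (rule subspace_diff[OF subspace_ndual s s])
  \<comment> \<open>The Cauchy condition in the norm, unfolded to values: a single \<open>M\<close>
    serves all tuples.\<close>
  have unif: "\<exists>M. \<forall>j\<ge>M. \<forall>k\<ge>M. \<forall>xs. length xs = n \<longrightarrow>
      \<bar>s j xs - s k xs\<bar> \<le> e * prod_list (map norm xs)" if e: "e > 0" for e
  proof -
    obtain M where M: "\<And>j k. j \<ge> M \<Longrightarrow> k \<ge> M \<Longrightarrow> ndual_norm n (s j - s k) < e"
      using cauchy[OF e] by blast
    have "\<bar>s j xs - s k xs\<bar> \<le> e * prod_list (map norm xs)"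
      if "j \<ge> M" "k \<ge> M" "length xs = n" for j k xs
      using abs_le_ndual_norm[OF diff that(3), of j k]
        mult_right_mono[OF less_imp_le[OF M[OF that(1,2)]] prod_list_norm_nonneg, of xs]
      by simp
    then show ?thesis by blast
  qed
  have "convergent (\<lambda>k. s k xs)" for xs
  proof (cases "length xs = n")
    case True
    let ?p = "prod_list (map norm xs)"
    have "Cauchy (\<lambda>k. s k xs)"
    proof (rule CauchyI)
      fix e :: real assume e: "e > 0"
      have p: "0 \<le> ?p" by (rule prod_list_norm_nonneg)
      \<comment> \<open>Dividing by \<open>?p + 1\<close> avoids division by zero when a zero entry
        makes \<open>?p\<close> vanish, and it makes the final bound strictly less than
        \<open>e\<close>.\<close>
      obtain M where M: "\<forall>j\<ge>M. \<forall>k\<ge>M. \<bar>s j xs - s k xs\<bar> \<le> e / (?p + 1) * ?p"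
        using unif[of "e / (?p + 1)"] e p True by fastforce
      have "e / (?p + 1) * ?p < e"
        using e p by (simp add: field_simps)
      with M show "\<exists>M. \<forall>j\<ge>M. \<forall>k\<ge>M. norm (s j xs - s k xs) < e"
        by (metis order_le_less_trans real_norm_def)
    qed
    then show ?thesis by (simp add: Cauchy_convergent_iff)
  next
    case False
    \<comment> \<open>All \<open>s k\<close> vanish at lists of other lengths, so the limit exists
      at every list and \<open>l\<close> is defined everywhere.\<close>
    then show ?thesis
      using s by (simp add: ndual_def convergent_const)
  qed
  then obtain l where l: "\<And>xs. (\<lambda>k. s k xs) \<longlonglongrightarrow> l xs"
    unfolding convergent_def by metis
  \<comment> \<open>Let \<open>k\<close> tend to infinity in \<open>unif\<close> with
    \<open>j\<close> fixed; \<open>M\<close> stays independent of \<open>xs\<close>.\<close>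
  have dist: "\<exists>M. \<forall>j\<ge>M. \<forall>xs. length xs = n \<longrightarrow>
      \<bar>s j xs - l xs\<bar> \<le> e * prod_list (map norm xs)" if e: "e > 0" for e
  proof -
    obtain M where M: "\<And>j k xs. j \<ge> M \<Longrightarrow> k \<ge> M \<Longrightarrow> length xs = n \<Longrightarrow>
        \<bar>s j xs - s k xs\<bar> \<le> e * prod_list (map norm xs)"
      using unif[OF e] by blast
    have "\<bar>s j xs - l xs\<bar> \<le> e * prod_list (map norm xs)" if "j \<ge> M" "length xs = n" for j xs
    proof (rule LIMSEQ_le_const2)
      show "(\<lambda>k. \<bar>s j xs - s k xs\<bar>) \<longlonglongrightarrow> \<bar>s j xs - l xs\<bar>"
        by (intro tendsto_intros l)
    qed (use M that in blast)
    then show ?thesis by blast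
  qed
  \<comment> \<open>A single term at distance at most 1 from \<open>l\<close> bounds
    \<open>l\<close>, with constant \<open>ndual_norm n (s M) + 1\<close>.\<close>
  obtain M where M: "\<And>xs. length xs = n \<Longrightarrow> \<bar>s M xs - l xs\<bar> \<le> 1 * prod_list (map norm xs)"
    using dist[of 1] by auto
  have "l \<in> ndual n"
  proof (rule ndualI)
    show "multilinear n l"
      by (rule multilinear_pointwise_limit[OF _ l]) (use s in \<open>simp add: ndual_def\<close>)
    show "l xs = 0" if "length xs \<noteq> n" for xs
      using l[of xs] s that by (simp add: ndual_def LIMSEQ_const_iff)
    show "\<bar>l xs\<bar> \<le> (ndual_norm n (s M) + 1) * prod_list (map norm xs)"
      if "length xs = n" for xs
      using M[OF that] abs_le_ndual_norm[OF s that, of M] by (simp add: distrib_right)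
  qed
  moreover have "(\<lambda>k. ndual_norm n (s k - l)) \<longlonglongrightarrow> 0"
  proof (rule LIMSEQ_I)
    fix r :: real assume r: "r > 0"
    \<comment> \<open>The supremum inherits only a non-strict bound, so \<open>r / 2\<close> is used
      to end strictly below \<open>r\<close>.\<close>
    obtain M where M: "\<And>j xs. j \<ge> M \<Longrightarrow> length xs = n \<Longrightarrow>
        \<bar>s j xs - l xs\<bar> \<le> r / 2 * prod_list (map norm xs)"
      using dist[of "r / 2"] r by auto
    have "norm (ndual_norm n (s j - l) - 0) < r" if "j \<ge> M" for j
    proof -
      have "ndual_norm n (s j - l) \<le> r / 2"
        using M[OF that] by (intro ndual_norm_le[OF nontrivial]) simp
      moreover have "0 \<le> ndual_norm n (s j - l)"
        by (rule ndual_norm_nonneg[OF nontrivial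
              subspace_diff[OF subspace_ndual s \<open>l \<in> ndual n\<close>]])
      ultimately show ?thesis using r by simp
    qed
    then show "\<exists>M. \<forall>j\<ge>M. norm (ndual_norm n (s j - l) - 0) < r"
      by blast
  qed
  ultimately show ?thesis by blast
qed

theorem theorem3p3:
  fixes n :: nat and B :: "'a::real_normed_vector set"
  assumes "independent B" and "span B = UNIV"
    and "infinite B \<or> n \<le> card B"
  shows "banach_space_on (ndual n :: ('a list \<Rightarrow> real) set) (ndual_norm n)"
proof -
  \<comment> \<open>Any element of the basis \<open>B\<close> is nonzero by independence; an empty
    \<open>B\<close> is finite of cardinality 0, which forces \<open>n = 0\<close>.\<close>
  have nontrivial: "n = 0 \<or> (\<exists>x::'a. x \<noteq> 0)"
  proof (cases "B = {}")
    case False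
    then obtain b where "b \<in> B" by auto
    then have "b \<noteq> 0"
      using \<open>independent B\<close> dependent_zero[of B] by metis
    then show ?thesis by auto
  qed (use assms(3) in simp)
  interpret normed_space_on "ndual n :: ('a list \<Rightarrow> real) set" "ndual_norm n"
    by (rule normed_space_on_ndual[OF nontrivial])
  show ?thesis
    by standard (rule ndual_complete[OF nontrivial]; simp)
qed

end
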